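(* Let $\mathcal{A}=\{A_1,\dots,A_m\}$ be a finite family of linear operators on $\mathbb{R}^d$ with probabilities $p_1,\dots,p_m$, sharing a common invariant cone $K$, and let $\lambda$ be its Lyapunov exponent. Then for an arbitrary functional $f$ on $K$ and for any $n\in\mathbb{N}$ we have $$F_{\min}^{(n)}\ \le\ \lambda\ \le\ F_{\max}^{(n)}.$$ In particular, $F_{\min}\le\lambda\le F_{\max}$.
   Context: Setting. $p_j>0$, $\sum_{j=1}^m p_j=1$. $K\subset\mathbb{R}^d$ is a convex, closed, solid (nonempty interior), pointed cone with apex at the origin, and $A_jK\subset K$ for all $j$. For $k\ge1$, $\mathcal{A}^k$ is the family of all $m^k$ products of length $k$ with the product probabilities, and $\mathbf{E}\{g(B)\mid B\in\mathcal{A}^k\}=\sum_{d_1,\dots,d_k}p_{d_1}\cdots p_{d_k}\,g(A_{d_k}\cdots A_{d_1})$. The Lyapunov exponent is $\lambda=\lim_{k\to\infty}\frac1k\mathbf{E}\{\log\|B\|\mid B\in\mathcal{A}^k\}$, with $\log0=-\infty$. A functional on $K$ is a map $f:K\to\mathbb{R}_+$ that is positive, i.e. $f(x)>0$ whenever $x\ne 0$, and homogeneous, i.e. $f(tx)=tf(x)$ for all $x\in K$, $t\in\mathbb{R}_+$. For such $f$ set $$F_{\min}^{(k)}=\frac1k\inf_{x\in K,\,f(x)=1}\mathbf{E}\{\log f(Bx)\mid B\in\mathcal{A}^k\},\qquad F_{\max}^{(k)}=\frac1k\sup_{x\in K,\,f(x)=1}\mathbf{E}\{\log f(Bx)\mid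 B\in\mathcal{A}^k\},$$ and $F_{\min}=F_{\min}^{(1)}$, $F_{\max}=F_{\max}^{(1)}$.
   Formalization: The functional f is additionally assumed comparable with the norm on K (c|x| ≤ f(x) ≤ C|x| with c > 0), as every continuous functional is; for arbitrary positive homogeneous f both inequalities can fail. *)

theory Defs
  imports "HOL-Analysis.Analysis"
begin

definition proper_cone :: "(real ^ 'd) set \<Rightarrow> bool" where
  "proper_cone K \<longleftrightarrow>
     cone K \<and> convex K \<and> closed K \<and> interior K \<noteq> {} \<and> (\<forall>x\<in>K. - x \<in> K \<longrightarrow> x = 0)"

definition elog :: "real \<Rightarrow> ereal" where
  "elog t = (if t > 0 then ereal (ln t) else -\<infinity>)"

definition words :: "nat \<Rightarrow> nat \<Rightarrow> nat list set" where
  "words m k = {ds. length ds = k \<and> set ds \<subseteq> {1..m}}"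

text \<open>The word \<open>[d\<^sub>1, \<dots>, d\<^sub>k]\<close> stands for \<open>A d\<^sub>k \<circ> \<dots> \<circ> A d\<^sub>1\<close>: the first letter acts first.\<close>

primrec word_prod :: "(nat \<Rightarrow> 'a \<Rightarrow> 'a) \<Rightarrow> nat list \<Rightarrow> 'a \<Rightarrow> 'a" where
  "word_prod A [] = id"
| "word_prod A (d # ds) = word_prod A ds \<circ> A d"

text \<open>In all uses \<open>g\<close> takes values in \<open>[-\<infinity>, \<infinity>)\<close> and the weights are positive, so no
  \<open>\<infinity> - \<infinity>\<close> or \<open>0 * \<infinity>\<close> occurs.\<close>

definition word_expectation ::
  "nat \<Rightarrow> (nat \<Rightarrow> real) \<Rightarrow> (nat \<Rightarrow> 'a \<Rightarrow> 'a) \<Rightarrow> nat \<Rightarrow> (('a \<Rightarrow> 'a) \<Rightarrow> ereal) \<Rightarrow> ereal" where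
  "word_expectation m p A k g =
     (\<Sum>ds\<in>words m k. ereal (prod_list (map p ds)) * g (word_prod A ds))"

definition lyapunov_exponent ::
  "nat \<Rightarrow> (nat \<Rightarrow> real) \<Rightarrow> (nat \<Rightarrow> real ^ 'd \<Rightarrow> real ^ 'd) \<Rightarrow> ereal" where
  "lyapunov_exponent m p A =
     lim (\<lambda>k. ereal (1 / real k) * word_expectation m p A k (\<lambda>B. elog (onorm B)))"

definition functional_on :: "(real ^ 'd) set \<Rightarrow> (real ^ 'd \<Rightarrow> real) \<Rightarrow> bool" where
  "functional_on K f \<longleftrightarrow>
     (\<forall>x\<in>K. 0 \<le> f x) \<and>
     (\<forall>x\<in>K. x \<noteq> 0 \<longrightarrow> 0 < f x) \<and>
     (\<forall>x\<in>K. \<forall>t\<ge>0. f (t *\<^sub>R x) = t * f x)"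

definition F_min ::
  "nat \<Rightarrow> (nat \<Rightarrow> real) \<Rightarrow> (nat \<Rightarrow> real ^ 'd \<Rightarrow> real ^ 'd) \<Rightarrow> (real ^ 'd) set
    \<Rightarrow> (real ^ 'd \<Rightarrow> real) \<Rightarrow> nat \<Rightarrow> ereal" where
  "F_min m p A K f k = ereal (1 / real k) *
     (INF x\<in>{x \<in> K. f x = 1}. word_expectation m p A k (\<lambda>B. elog (f (B x))))"

definition F_max ::
  "nat \<Rightarrow> (nat \<Rightarrow> real) \<Rightarrow> (nat \<Rightarrow> real ^ 'd \<Rightarrow> real ^ 'd) \<Rightarrow> (real ^ 'd) set
    \<Rightarrow> (real ^ 'd \<Rightarrow> real) \<Rightarrow> nat \<Rightarrow> ereal" where
  "F_max m p A K f k = ereal (1 / real k) *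
     (SUP x\<in>{x \<in> K. f x = 1}. word_expectation m p A k (\<lambda>B. elog (f (B x))))"

text \<open>
  Positivity and homogeneity alone do not tie \<open>f\<close> to the norm, and then the bounds
  \<open>F_min \<le> \<lambda> \<le> F_max\<close> can fail. Take the closed quadrant in the plane,
  \<open>A\<^sub>1 (x, y) = (0, x + y)\<close> and \<open>A\<^sub>2 (x, y) = (x + y, y)\<close> with weights 1/2, and
  \<open>f (x, y) = (x + y) * exp (2 s (1 - 2 powr (x / y)))\<close> for \<open>y > 0\<close>,
  \<open>f (x, 0) = x * exp (2 s)\<close>. Since \<open>A\<^sub>1\<close> and \<open>A\<^sub>2\<close> do not decrease \<open>x + y\<close>, and increase it
  by at most the factors 1 and 2, \<open>0 \<le> \<lambda> \<le> ln 2 / 2\<close>. However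
  \<open>F_max \<le> ln 2 / 2 - 1 < 0\<close> for \<open>s = 1\<close>, and \<open>F_min \<ge> 1 > ln 2 / 2\<close> for \<open>s = -1\<close>.

  The following condition excludes this. It holds for every continuous functional (lemma
  below), but also for functionals that are discontinuous along the boundary of the cone, such
  as positive concave ones on a polyhedral cone.
\<close>

definition norm_comparable_on :: "(real ^ 'd) set \<Rightarrow> (real ^ 'd \<Rightarrow> real) \<Rightarrow> bool" where
  "norm_comparable_on K f \<longleftrightarrow>
     (\<exists>c C. 0 < c \<and> (\<forall>x\<in>K. c * norm x \<le> f x \<and> f x \<le> C * norm x))"

lemma continuous_functional_norm_comparable:
  assumes K: "proper_cone K" and f: "functional_on K f" and cont: "continuous_on (K - {0}) f"
  shows "norm_comparable_on K f"
proof -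
  define S where "S = K \<inter> sphere 0 1"
  have compS: "compact S"
    using K unfolding S_def proper_cone_def by (simp add: closed_Int_compact)
  have contS: "continuous_on S f"
    by (rule continuous_on_subset[OF cont]) (auto simp: S_def)
  have "\<exists>c C. 0 < c \<and> (\<forall>y\<in>S. c \<le> f y \<and> f y \<le> C)"
  proof (cases "S = {}")
    case True
    then show ?thesis by (auto intro: exI[of _ 1])
  next
    case False
    obtain a where a: "a \<in> S" "\<forall>y\<in>S. f a \<le> f y"
      using continuous_attains_inf[OF compS False contS] by blast
    obtain b where b: "b \<in> S" "\<forall>y\<in>S. f y \<le> f b"
      using continuous_attains_sup[OF compS False contS] by blast
    have "0 < f a" using a(1) f unfolding S_def functional_on_def by force
    then show ?thesis using a b by blast
  qed
  then obtain c C where c: "0 < c" and cC: "\<And>y. y \<in> S \<Longrightarrow> c \<le> f y \<and> f y \<le> C" by blast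
  have "c * norm x \<le> f x \<and> f x \<le> C * norm x" if x: "x \<in> K" for x
  proof (cases "x = 0")
    case True
    have "f (0 *\<^sub>R x) = 0 * f x" using f x unfolding functional_on_def by blast
    then show ?thesis using True by simp
  next
    case False
    define y where "y = (1 / norm x) *\<^sub>R x"
    have y: "y \<in> S" using K x False
      by (auto simp: S_def y_def proper_cone_def cone_def)
    then have yK: "y \<in> K" by (simp add: S_def)
    have "x = norm x *\<^sub>R y" using False by (simp add: y_def)
    then have "f x = norm x * f y" using f yK unfolding functional_on_def
      by (metis norm_ge_zero)
    moreover have "c * norm x \<le> norm x * f y" "norm x * f y \<le> C * norm x"
      using cC[OF y] mult_right_mono[of _ _ "norm x"] by (auto simp: mult.commute[of "norm x"])
    ultimately show ?thesis by simp
  qed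
  with c show ?thesis unfolding norm_comparable_on_def by blast
qed

end

theory Submission
  imports Defs
begin

text \<open>By Fekete's lemma \<open>\<lambda>\<close> is both the limit and the infimum of the averages
  \<open>E (log \<parallel>B\<parallel>) / k\<close>. An estimate \<open>E (log f (B x)) \<le> n c + log f x\<close> on the cone, for
  words of length \<open>n\<close>, can be iterated by conditioning on the first block of letters, and gives
  \<open>E (log f (B x)) \<le> k n c + log f x\<close> for words of length \<open>k n\<close>; likewise for \<open>\<ge>\<close>. Take \<open>x = e\<close>
  interior to the cone. Since the cone is normal, \<open>\<parallel>B\<parallel>\<close> and \<open>f (B e)\<close> agree up to
  constant factors for every operator \<open>B\<close> that preserves the cone, so dividing by \<open>k n\<close> and letting
  \<open>k\<close> tend to infinity yields both bounds.\<close>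

section \<open>Subadditive sequences of extended reals\<close>

lemma ereal_average_le_iff:
  assumes "n \<ge> 1"
  shows "ereal (1 / real n) * x \<le> ereal c \<longleftrightarrow> x \<le> ereal (real n * c)"
  using assms by (cases x) (auto simp: field_simps)

lemma ereal_le_average_iff:
  assumes "n \<ge> 1"
  shows "ereal c \<le> ereal (1 / real n) * x \<longleftrightarrow> ereal (real n * c) \<le> x"
  using assms by (cases x) (auto simp: field_simps)

text \<open>The induction step of every iteration below: one more block adds one more
  \<open>c\<close>, also when \<open>x\<close> is infinite.\<close>

lemma ereal_add_mult_of_nat:
  "ereal c + (ereal (real q * c) + x) = ereal (real (Suc q) * c) + x"
  by (cases x) (auto simp: algebra_simps)

text \<open>Peel off \<open>q\<close> blocks of length \<open>k\<close>. A real bound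
  \<open>c\<close> in place of \<open>a k\<close> keeps the arithmetic finite when
  \<open>a k\<close> is -\<infinity>.\<close>

lemma subadditive_mult_le:
  fixes a :: "nat \<Rightarrow> ereal"
  assumes sub: "\<And>i j. a (i + j) \<le> a i + a j" and k: "a k \<le> ereal c"
  shows "a (q * k + r) \<le> ereal (real q * c) + a r"
proof (induction q)
  case (Suc q)
  have "a (Suc q * k + r) \<le> a k + a (q * k + r)"
    using sub[of k "q * k + r"] by (simp add: add.assoc)
  also have "\<dots> \<le> ereal c + (ereal (real q * c) + a r)"
    by (rule add_mono[OF k Suc.IH])
  also have "\<dots> = ereal (real (Suc q) * c) + a r"
    by (rule ereal_add_mult_of_nat)
  finally show ?case .
qed simp

lemma eventually_ereal_div_less:
  assumes "ereal c < l"
  shows "eventually (\<lambda>n. ereal (c + D / real n) < l) sequentially"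
proof -
  have "(\<lambda>n. c + D / real n) \<longlonglongrightarrow> c + 0"
    by (intro tendsto_intros lim_const_over_n)
  then have "(\<lambda>n. ereal (c + D / real n)) \<longlonglongrightarrow> ereal c"
    by simp
  then show ?thesis using assms by (rule order_tendstoD(2))
qed

text \<open>The averages lie above their infimum. Conversely, if the average at \<open>k\<close> is
  below a real \<open>c\<close>, division of \<open>n\<close> by \<open>k\<close> with remainder
  bounds \<open>a n\<close> by \<open>n * c\<close> plus a constant. The index 0 is left out of the
  infimum: there 1 / 0 = 0 makes the average 0.\<close>

lemma fekete_ereal:
  fixes a :: "nat \<Rightarrow> ereal"
  assumes sub: "\<And>i j. a (i + j) \<le> a i + a j" and fin: "\<And>i. a i < \<infinity>"
  shows "(\<lambda>k. ereal (1 / real k) * a k) \<longlonglongrightarrow> (INF k\<in>{1..}. ereal (1 / real k) * a k)"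
    (is "?u \<longlonglongrightarrow> ?L")
proof (rule order_tendstoI)
  fix l assume l: "l < ?L"
  have "l < ?u k" if "k \<ge> 1" for k
    using l by (rule less_le_trans) (use that in \<open>auto intro: INF_lower\<close>)
  then show "eventually (\<lambda>k. l < ?u k) sequentially"
    using eventually_sequentially by blast
next
  fix l assume "?L < l"
  then obtain c where c: "?L < ereal c" "ereal c < l" using ereal_dense2 by blast
  from c(1) obtain k where k: "k \<ge> 1" "?u k < ereal c" by (auto simp: INF_less_iff)
  have ak: "a k \<le> ereal (real k * c)"
    using k(2) ereal_average_le_iff[OF k(1)] by (metis less_imp_le)
  \<comment> \<open>The finitely many remainders share a real upper bound \<open>D\<close>; their
    maximum itself may be -\<infinity>.\<close>
  have "Max (a ` {..<k}) \<in> a ` {..<k}" using k(1) by (intro Max_in) (auto simp: lessThan_empty_iff)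
  then have "Max (a ` {..<k}) < \<infinity>" using fin by (metis imageE)
  then obtain D where "Max (a ` {..<k}) \<le> ereal D"
    by (metis less_le ereal_dense2)
  then have D: "a r \<le> ereal D" if "r < k" for r
    using that by (meson Max_ge finite_imageI finite_lessThan imageI lessThan_iff order_trans)
  \<comment> \<open>Replacing \<open>q * k * c\<close> by \<open>n * c\<close> costs
    \<open>- r * c\<close>, which is at most \<open>k * \<bar>c\<bar>\<close> for either sign of
    \<open>c\<close>.\<close>
  define D' where "D' = D + real k * \<bar>c\<bar>"
  have bound: "a n \<le> ereal (real n * c + D')" for n
  proof -
    define q r where "q = n div k" and "r = n mod k"
    have n: "n = q * k + r" and r: "r < k" using k(1) by (auto simp: q_def r_def)
    have "- (real r * c) \<le> real r * \<bar>c\<bar>"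
      using mult_left_mono[of "- c" "\<bar>c\<bar>" "real r"] by simp
    also have "\<dots> \<le> real k * \<bar>c\<bar>" using r by (intro mult_right_mono) auto
    finally have rc: "- (real r * c) \<le> real k * \<bar>c\<bar>" .
    have "a n \<le> ereal (real q * (real k * c)) + a r"
      unfolding n by (rule subadditive_mult_le[OF sub ak])
    also have "\<dots> \<le> ereal (real q * (real k * c)) + ereal D"
      by (rule add_left_mono[OF D[OF r]])
    also have "\<dots> \<le> ereal (real n * c + D')"
      using rc by (simp add: n D'_def algebra_simps)
    finally show ?thesis .
  qed
  have u: "?u n \<le> ereal (c + D' / real n)" if "n \<ge> 1" for n
    unfolding ereal_average_le_iff[OF that] using bound[of n] that by (simp add: algebra_simps)
  show "eventually (\<lambda>n. ?u n < l) sequentially"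
    using eventually_ereal_div_less[OF c(2)] eventually_ge_at_top[of 1]
    by eventually_elim (use u le_less_trans in blast)
qed

section \<open>Expectations over words\<close>

lemma words_0: "words m 0 = {[]}"
  by (auto simp: words_def)

lemma words_Suc: "words m (Suc k) = (\<lambda>(d, ds). d # ds) ` ({1..m} \<times> words m k)"
  by (auto simp: words_def length_Suc_conv image_iff)

lemma sum_words_Suc:
  "(\<Sum>ds\<in>words m (Suc k). F ds) = (\<Sum>d\<in>{1..m}. \<Sum>ds\<in>words m k. F (d # ds))"
proof -
  have "inj_on (\<lambda>(d, ds). d # ds) ({1..m} \<times> words m k)" by (auto simp: inj_on_def)
  then have "(\<Sum>ds\<in>words m (Suc k). F ds) = (\<Sum>(d, ds)\<in>{1..m} \<times> words m k. F (d # ds))"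
    unfolding words_Suc by (simp add: sum.reindex case_prod_unfold)
  then show ?thesis by (simp add: sum.cartesian_product)
qed

lemma sum_words_add:
  "(\<Sum>ds\<in>words m (j + k). F ds) = (\<Sum>us\<in>words m j. \<Sum>vs\<in>words m k. F (us @ vs))"
  by (induction j arbitrary: F) (simp_all add: words_0 sum_words_Suc)

lemma word_prod_append: "word_prod A (us @ vs) = word_prod A vs \<circ> word_prod A us"
  by (induction us) (simp_all add: o_assoc)

text \<open>A new first letter acts before the others, so the induction step composes with
  \<open>A d\<close> on the right.\<close>

lemma word_prod_induct:
  assumes "ds \<in> words m k" and "P id"
    and "\<And>d B. d \<in> {1..m} \<Longrightarrow> P B \<Longrightarrow> P (B \<circ> A d)"
  shows "P (word_prod A ds)"
  using assms(1)
proof (induction k arbitrary: ds)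
  case 0
  then show ?case using assms(2) by (simp add: words_0 id_def)
next
  case (Suc k)
  then obtain d es where "ds = d # es" "d \<in> {1..m}" "es \<in> words m k"
    by (auto simp: words_Suc)
  then show ?case using Suc.IH[of es] assms(3)[of d "word_prod A es"] by (simp add: comp_def)
qed

lemma ereal_mult_sum:
  fixes g :: "'a \<Rightarrow> ereal"
  assumes "0 \<le> c"
  shows "ereal c * (\<Sum>i\<in>I. g i) = (\<Sum>i\<in>I. ereal c * g i)"
  by (induction I rule: infinite_finite_induct) (simp_all add: assms ereal_pos_distrib)

section \<open>Weighted averages with values in the extended reals\<close>

locale word_weights =
  fixes m :: nat and p :: "nat \<Rightarrow> real"
  assumes weight_pos: "\<And>j. j \<in> {1..m} \<Longrightarrow> 0 < p j"
    and sum_weights: "(\<Sum>j = 1..m. p j) = 1"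
begin

lemma word_weight_pos: "ds \<in> words m k \<Longrightarrow> 0 < prod_list (map p ds)"
  by (induction k arbitrary: ds) (auto simp: words_0 words_Suc intro!: mult_pos_pos weight_pos)

lemma sum_word_weights: "(\<Sum>ds\<in>words m k. prod_list (map p ds)) = 1"
proof (induction k)
  case (Suc k)
  then show ?case
    using sum_weights by (simp add: sum_words_Suc flip: sum_distrib_left)
qed (simp add: words_0)

lemma word_expectation_mono:
  assumes "\<And>ds. ds \<in> words m k \<Longrightarrow> g (word_prod A ds) \<le> h (word_prod A ds)"
  shows "word_expectation m p A k g \<le> word_expectation m p A k h"
  unfolding word_expectation_def
  by (intro sum_mono ereal_mult_left_mono assms)
     (use word_weight_pos in \<open>auto intro: less_imp_le\<close>)

text \<open>Additivity survives infinite values because a positive real weight distributes over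
  every sum in \<open>ereal\<close>.\<close>

lemma word_expectation_add:
  "word_expectation m p A k (\<lambda>B. g B + h B) =
     word_expectation m p A k g + word_expectation m p A k h"
proof -
  have "ereal (prod_list (map p ds)) * (a + b) =
      ereal (prod_list (map p ds)) * a + ereal (prod_list (map p ds)) * b"
    if "ds \<in> words m k" for ds a b
    using word_weight_pos[OF that] by (intro ereal_pos_distrib) auto
  then show ?thesis
    unfolding word_expectation_def by (simp add: sum.distrib)
qed

lemma word_expectation_const: "word_expectation m p A k (\<lambda>_. c) = c"
proof -
  have "word_expectation m p A k (\<lambda>_. c) = (\<Sum>ds\<in>words m k. ereal (prod_list (map p ds))) * c"
    unfolding word_expectation_def
    by (intro sum_ereal_left_distrib[symmetric]) (use word_weight_pos in \<open>auto intro: less_imp_le\<close>)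
  then show ?thesis by (simp add: sum_word_weights)
qed

text \<open>The tower property: condition on the first \<open>j\<close> letters. Their product
  \<open>B\<close> acts first, hence \<open>C \<circ> B\<close>.\<close>

lemma word_expectation_split:
  "word_expectation m p A (j + k) g =
     word_expectation m p A j (\<lambda>B. word_expectation m p A k (\<lambda>C. g (C \<circ> B)))"
proof -
  have "ereal (prod_list (map p us)) *
      (\<Sum>vs\<in>words m k. ereal (prod_list (map p vs)) * g (word_prod A vs \<circ> word_prod A us)) =
      (\<Sum>vs\<in>words m k. ereal (prod_list (map p (us @ vs))) * g (word_prod A (us @ vs)))"
    if "us \<in> words m j" for us
    using word_weight_pos[OF that]
    by (subst ereal_mult_sum) (auto simp: word_prod_append mult.assoc simp flip: times_ereal.simps(1))
  then show ?thesis
    unfolding word_expectation_def sum_words_add by simp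
qed

lemma word_expectation_less_PInf:
  assumes "\<And>B. g B < \<infinity>"
  shows "word_expectation m p A k g < \<infinity>"
proof -
  have "ereal (prod_list (map p ds)) * g (word_prod A ds) \<noteq> \<infinity>" if "ds \<in> words m k" for ds
    using word_weight_pos[OF that] assms[of "word_prod A ds"] by (cases "g (word_prod A ds)") auto
  then show ?thesis
    unfolding word_expectation_def by (auto simp: sum_Pinfty less_top[symmetric])
qed

end

section \<open>Logarithms and operators on a cone\<close>

lemma elog_mono: "s \<le> t \<Longrightarrow> elog s \<le> elog t"
  by (auto simp: elog_def)

lemma elog_mult: "0 \<le> s \<Longrightarrow> 0 \<le> t \<Longrightarrow> elog (s * t) = elog s + elog t"
  by (auto simp: elog_def ln_mult zero_less_mult_iff)

lemma elog_less_PInf: "elog t < \<infinity>"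
  by (simp add: elog_def)

text \<open>Normality of the cone. The unit vectors of \<open>K\<close> form a compact set, disjoint
  from the closed set \<open>- K\<close> by pointedness, so the two have a positive distance
  \<open>c\<close>; the general case follows by scaling.\<close>

lemma proper_cone_normal:
  assumes K: "proper_cone K"
  obtains c where "0 < c" and "\<And>x y. x \<in> K \<Longrightarrow> y \<in> K \<Longrightarrow> c * norm x \<le> norm (x + y)"
proof -
  have clK: "closed K" and scale: "\<And>x t. x \<in> K \<Longrightarrow> 0 \<le> t \<Longrightarrow> t *\<^sub>R x \<in> K"
    and pointed: "\<And>x. x \<in> K \<Longrightarrow> - x \<in> K \<Longrightarrow> x = 0"
    using K by (auto simp: proper_cone_def cone_def)
  have disj: "(K \<inter> sphere 0 1) \<inter> uminus ` K = {}"
    using pointed by fastforce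
  obtain c where c: "0 < c" "\<forall>x\<in>K \<inter> sphere 0 1. \<forall>y\<in>uminus ` K. c \<le> dist x y"
    using separate_compact_closed[OF closed_Int_compact[OF clK compact_sphere] closed_negations[OF clK] disj]
    by blast
  have "c * norm x \<le> norm (x + y)" if x: "x \<in> K" and y: "y \<in> K" for x y
  proof (cases "x = 0")
    case False
    let ?t = "1 / norm x"
    have "?t *\<^sub>R x \<in> K \<inter> sphere 0 1" "- (?t *\<^sub>R y) \<in> uminus ` K"
      using scale x y False by auto
    then have "c \<le> dist (?t *\<^sub>R x) (- (?t *\<^sub>R y))" using c(2) by blast
    also have "\<dots> = norm (?t *\<^sub>R (x + y))" by (simp add: dist_norm scaleR_add_right)
    also have "\<dots> = norm (x + y) / norm x" by simp
    finally show ?thesis using False by (simp add: field_simps)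
  qed simp
  with c(1) show ?thesis by (rule that)
qed

text \<open>If \<open>e + z\<close> and \<open>e - z\<close> lie in \<open>K\<close>, their images
  lie in \<open>K\<close> and sum to \<open>2 B e\<close>, so normality bounds both images by
  \<open>norm (B e)\<close>; subtracting \<open>B e\<close> bounds \<open>B z\<close>. The constant
  does not depend on \<open>B\<close>.\<close>

lemma onorm_le_norm_interior_image:
  assumes K: "proper_cone K" and e: "e \<in> interior K"
  obtains C where "0 < C"
    and "\<And>B. linear B \<Longrightarrow> B ` K \<subseteq> K \<Longrightarrow> onorm B \<le> C * norm (B e)"
proof -
  obtain c where c: "0 < c" "\<And>x y. x \<in> K \<Longrightarrow> y \<in> K \<Longrightarrow> c * norm x \<le> norm (x + y)"
    using proper_cone_normal[OF K] by blast
  obtain r where r: "0 < r" "cball e r \<subseteq> K" using e by (auto simp: mem_interior_cball)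
  \<comment> \<open>The term 2 / \<open>c\<close> bounds \<open>B e + B ?z\<close>, the 1 pays for
    removing \<open>B e\<close>, and the division by \<open>r\<close> undoes the scaling of
    \<open>x\<close> to length \<open>r\<close>.\<close>
  define C where "C = (1 + 2 / c) / r"
  have "0 < C" using c r by (simp add: C_def add_pos_pos)
  moreover have "onorm B \<le> C * norm (B e)" if lin: "linear B" and BK: "B ` K \<subseteq> K" for B
  proof (rule onorm_le)
    fix x
    show "norm (B x) \<le> C * norm (B e) * norm x"
    proof (cases "x = 0")
      case True
      then show ?thesis using lin by (simp add: linear_0)
    next
      case False
      let ?z = "(r / norm x) *\<^sub>R x"
      have "norm ?z = r" using False r(1) by simp
      then have "e + ?z \<in> K" "e - ?z \<in> K"
        using r(2) by (auto simp: subset_iff dist_norm)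
      then have "B (e + ?z) \<in> K" "B (e - ?z) \<in> K" using BK by auto
      then have "c * norm (B (e + ?z)) \<le> norm (B (e + ?z) + B (e - ?z))" by (rule c(2))
      also have "B (e + ?z) + B (e - ?z) = 2 *\<^sub>R B e"
        by (simp add: linear_add[OF lin] linear_diff[OF lin] scaleR_2)
      finally have sum_le: "norm (B e + B ?z) \<le> 2 / c * norm (B e)"
        using c(1) by (simp add: linear_add[OF lin] field_simps)
      have "norm (B ?z) \<le> norm (B e + B ?z) + norm (B e)"
        using norm_triangle_ineq4[of "B e + B ?z" "B e"] by simp
      also have "\<dots> \<le> (1 + 2 / c) * norm (B e)" using sum_le by (simp add: algebra_simps)
      finally have "r / norm x * norm (B x) \<le> (1 + 2 / c) * norm (B e)"
        using r(1) by (simp add: linear_scale[OF lin])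
      then show ?thesis using r(1) False by (simp add: C_def field_simps)
    qed
  qed
  ultimately show ?thesis by (rule that)
qed

text \<open>A nonzero \<open>e\<close> has \<open>f e > 0\<close>, so that \<open>ln (f e)\<close>
  is a harmless constant in the final estimates.\<close>

lemma proper_cone_interior_nonzero:
  fixes K :: "(real ^ 'd) set"
  assumes "proper_cone K"
  obtains e where "e \<in> interior K" and "e \<noteq> 0"
proof -
  have "interior K \<noteq> {}" using assms by (simp add: proper_cone_def)
  moreover have "interior K \<noteq> {0}" using open_interior[of K] not_open_singleton by metis
  ultimately show ?thesis using that by blast
qed

section \<open>The Lyapunov exponent of operators sharing a cone\<close>

locale random_cone_operators = word_weights m p
  for m :: nat and p :: "nat \<Rightarrow> real" +
  fixes A :: "nat \<Rightarrow> real ^ 'd \<Rightarrow> real ^ 'd" and K :: "(real ^ 'd) set" and f :: "real ^ 'd \<Rightarrow> real"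
  assumes lin: "\<And>j. j \<in> {1..m} \<Longrightarrow> linear (A j)"
    and K: "proper_cone K"
    and inv: "\<And>j. j \<in> {1..m} \<Longrightarrow> A j ` K \<subseteq> K"
    and f: "functional_on K f"
    and f_norm: "norm_comparable_on K f"
begin

lemma linear_word_prod: "ds \<in> words m k \<Longrightarrow> linear (word_prod A ds)"
  by (erule word_prod_induct; intro linear_id linear_compose lin)

lemma word_prod_cone: "ds \<in> words m k \<Longrightarrow> word_prod A ds ` K \<subseteq> K"
  by (erule word_prod_induct) (use inv in \<open>auto simp: image_subset_iff\<close>)

lemma onorm_word_prod_nonneg: "ds \<in> words m k \<Longrightarrow> 0 \<le> onorm (word_prod A ds)"
  using linear_word_prod by (auto intro!: onorm_pos_le simp: linear_linear)

text \<open>Submultiplicativity of the operator norm, averaged by conditioning on the first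
  \<open>j\<close> letters.\<close>

lemma word_expectation_elog_onorm_subadditive:
  "word_expectation m p A (j + k) (\<lambda>B. elog (onorm B)) \<le>
     word_expectation m p A j (\<lambda>B. elog (onorm B)) + word_expectation m p A k (\<lambda>B. elog (onorm B))"
proof -
  have "word_expectation m p A (j + k) (\<lambda>B. elog (onorm B)) =
      word_expectation m p A j (\<lambda>B. word_expectation m p A k (\<lambda>C. elog (onorm (C \<circ> B))))"
    by (rule word_expectation_split)
  also have "\<dots> \<le> word_expectation m p A j (\<lambda>B. word_expectation m p A k
      (\<lambda>C. elog (onorm B) + elog (onorm C)))"
  proof (intro word_expectation_mono)
    fix us vs assume u: "us \<in> words m j" and v: "vs \<in> words m k"
    have "onorm (word_prod A vs \<circ> word_prod A us) \<le> onorm (word_prod A vs) * onorm (word_prod A us)"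
      using linear_word_prod[OF u] linear_word_prod[OF v]
      by (intro onorm_compose) (simp_all add: linear_linear)
    then have "elog (onorm (word_prod A vs \<circ> word_prod A us)) \<le>
        elog (onorm (word_prod A vs) * onorm (word_prod A us))"
      by (rule elog_mono)
    also have "\<dots> = elog (onorm (word_prod A us)) + elog (onorm (word_prod A vs))"
      using onorm_word_prod_nonneg u v by (simp add: elog_mult add.commute)
    finally show "elog (onorm (word_prod A vs \<circ> word_prod A us)) \<le> \<dots>" .
  qed
  finally show ?thesis by (simp add: word_expectation_add word_expectation_const)
qed

lemma averages_tendsto:
  "(\<lambda>k. ereal (1 / real k) * word_expectation m p A k (\<lambda>B. elog (onorm B)))
     \<longlonglongrightarrow> (INF k\<in>{1..}. ereal (1 / real k) * word_expectation m p A k (\<lambda>B. elog (onorm B)))"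
  by (rule fekete_ereal[OF word_expectation_elog_onorm_subadditive
        word_expectation_less_PInf[OF elog_less_PInf]])

text \<open>Convergence of the averages makes the \<open>lim\<close> in the definition a genuine
  limit.\<close>

lemma lyapunov_exponent_eq_INF:
  "lyapunov_exponent m p A =
     (INF k\<in>{1..}. ereal (1 / real k) * word_expectation m p A k (\<lambda>B. elog (onorm B)))"
  unfolding lyapunov_exponent_def by (rule limI[OF averages_tendsto])

text \<open>Since \<lambda> is an infimum, one average at a multiple of \<open>n\<close> suffices,
  with \<open>q\<close> so large that \<open>D / (q * n)\<close> is negligible.\<close>

lemma lyapunov_exponent_le:
  assumes n: "n \<ge> 1"
    and bound: "\<And>q. word_expectation m p A (q * n) (\<lambda>B. elog (onorm B)) \<le> ereal (real q * (real n * c) + D)"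
  shows "lyapunov_exponent m p A \<le> ereal c"
proof (rule dense_ge)
  fix l assume l: "ereal c < l"
  obtain q where q: "q \<ge> 1" "ereal (c + (D / real n) / real q) < l"
    using eventually_happens'[OF _ eventually_conj[OF eventually_ge_at_top[of 1]
          eventually_ereal_div_less[OF l, of "D / real n"]]] by auto
  have qn: "1 \<le> q * n" using n q by simp
  have "lyapunov_exponent m p A \<le>
      ereal (1 / real (q * n)) * word_expectation m p A (q * n) (\<lambda>B. elog (onorm B))"
    unfolding lyapunov_exponent_eq_INF by (rule INF_lower) (use qn in simp)
  also have "\<dots> \<le> ereal (c + (D / real n) / real q)"
  proof -
    have "real (q * n) * (c + (D / real n) / real q) = real q * (real n * c) + D"
      using n q(1) by (simp add: field_simps)
    then show ?thesis unfolding ereal_average_le_iff[OF qn] using bound[of q] by simp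
  qed
  finally show "lyapunov_exponent m p A \<le> l" using q(2) by simp
qed

text \<open>Lower bounds at multiples of \<open>n\<close> say nothing directly about the other
  averages, so here \<lambda> is used as a limit, taken along the subsequence
  \<open>q * n\<close>.\<close>

lemma lyapunov_exponent_ge:
  assumes n: "n \<ge> 1"
    and bound: "\<And>q. ereal (real q * (real n * c) - D) \<le> word_expectation m p A (q * n) (\<lambda>B. elog (onorm B))"
  shows "ereal c \<le> lyapunov_exponent m p A"
proof -
  define u where "u k = ereal (1 / real k) * word_expectation m p A k (\<lambda>B. elog (onorm B))" for k
  have "filterlim (\<lambda>q. q * n) at_top sequentially"
    using n by (intro mult_nat_right_at_top) simp
  moreover have "u \<longlonglongrightarrow> lyapunov_exponent m p A"
    unfolding u_def using averages_tendsto by (simp add: lyapunov_exponent_eq_INF)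
  ultimately have 1: "(\<lambda>q. u (q * n)) \<longlonglongrightarrow> lyapunov_exponent m p A"
    using filterlim_compose by blast
  have "(\<lambda>q. c - (D / real n) / real q) \<longlonglongrightarrow> c - 0"
    by (intro tendsto_intros lim_const_over_n)
  then have 2: "(\<lambda>q. ereal (c - (D / real n) / real q)) \<longlonglongrightarrow> ereal c" by simp
  have "ereal (c - (D / real n) / real q) \<le> u (q * n)" if "q \<ge> 1" for q
  proof -
    have qn: "1 \<le> q * n" using n that by simp
    have "real (q * n) * (c - (D / real n) / real q) = real q * (real n * c) - D"
      using n that by (simp add: field_simps)
    then show ?thesis
      unfolding u_def ereal_le_average_iff[OF qn] using bound[of q] by simp
  qed
  then show ?thesis
    by (intro LIMSEQ_le[OF 2 1]) blast
qed

section \<open>Estimates for one block and their iteration\<close>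

lemma f_zero: "f 0 = 0"
proof -
  obtain x where "x \<in> K" using K interior_subset by (fastforce simp: proper_cone_def)
  then have "0 *\<^sub>R x \<in> K" using K unfolding proper_cone_def cone_def by blast
  then have "0 \<in> K" by simp
  then have "f (0 *\<^sub>R 0) = 0 * f 0" using f unfolding functional_on_def by blast
  then show ?thesis by simp
qed

lemma f_pos: "x \<in> K \<Longrightarrow> x \<noteq> 0 \<Longrightarrow> 0 < f x"
  using f by (auto simp: functional_on_def)

lemma elog_f: "x \<in> K \<Longrightarrow> x \<noteq> 0 \<Longrightarrow> elog (f x) = ereal (ln (f x))"
  using f_pos by (simp add: elog_def)

text \<open>Reduces nonzero vectors of the cone to the section \<open>f y = 1\<close>, over which
  \<open>F_min\<close> and \<open>F_max\<close> are taken.\<close>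

lemma f_normalize:
  assumes x: "x \<in> K" "x \<noteq> 0"
  obtains y where "y \<in> K" "f y = 1" "x = f x *\<^sub>R y"
proof
  let ?y = "(1 / f x) *\<^sub>R x"
  have "f ?y = 1 / f x * f x"
    using f x(1) f_pos[OF x] unfolding functional_on_def by (meson less_imp_le zero_le_divide_1_iff)
  then show "f ?y = 1" using f_pos[OF x] by simp
  show "?y \<in> K" using K x f_pos[OF x] by (auto simp: proper_cone_def cone_def)
  show "x = f x *\<^sub>R ?y" using f_pos[OF x] by simp
qed

lemma word_expectation_elog_scale:
  assumes y: "y \<in> K" and t: "0 < t"
  shows "word_expectation m p A n (\<lambda>B. elog (f (B (t *\<^sub>R y)))) =
    ereal (ln t) + word_expectation m p A n (\<lambda>B. elog (f (B y)))"
proof -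
  have "elog (f (word_prod A ds (t *\<^sub>R y))) = ereal (ln t) + elog (f (word_prod A ds y))"
    if ds: "ds \<in> words m n" for ds
  proof -
    have BK: "word_prod A ds y \<in> K" using word_prod_cone[OF ds] y by auto
    have "f (word_prod A ds (t *\<^sub>R y)) = t * f (word_prod A ds y)"
      using f BK t by (simp add: linear_scale[OF linear_word_prod[OF ds]] functional_on_def)
    then show ?thesis
      using f BK t elog_mult[of t "f (word_prod A ds y)"] by (simp add: functional_on_def elog_def)
  qed
  then have "word_expectation m p A n (\<lambda>B. elog (f (B (t *\<^sub>R y)))) =
    word_expectation m p A n (\<lambda>B. ereal (ln t) + elog (f (B y)))"
    unfolding word_expectation_def by (intro sum.cong) auto
  then show ?thesis by (simp add: word_expectation_add word_expectation_const)
qed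

lemma word_expectation_elog_zero:
  "word_expectation m p A n (\<lambda>B. elog (f (B 0))) = - \<infinity>"
proof -
  have "word_expectation m p A n (\<lambda>B. elog (f (B 0))) = word_expectation m p A n (\<lambda>_. - \<infinity>)"
    unfolding word_expectation_def
    by (intro sum.cong) (simp_all add: linear_0[OF linear_word_prod] f_zero elog_def)
  then show ?thesis by (simp add: word_expectation_const)
qed

text \<open>Homogeneity carries the bound from the section \<open>f y = 1\<close> to the cone. The
  point 0 is included because a product may kill a nonzero vector; both sides are then
  -\<infinity>.\<close>

lemma step_le:
  assumes n: "n \<ge> 1" and c: "F_max m p A K f n \<le> ereal c" and x: "x \<in> K"
  shows "word_expectation m p A n (\<lambda>B. elog (f (B x))) \<le> ereal (real n * c) + elog (f x)"
proof (cases "x = 0")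
  case False
  then obtain y where y: "y \<in> K" "f y = 1" "x = f x *\<^sub>R y" using f_normalize[OF x] by blast
  have "word_expectation m p A n (\<lambda>B. elog (f (B y))) \<le> ereal (real n * c)"
    using c y unfolding F_max_def ereal_average_le_iff[OF n] SUP_le_iff by blast
  then show ?thesis
    using word_expectation_elog_scale[OF y(1) f_pos[OF x False], of n] add_left_mono
    by (simp only: y(3)[symmetric] elog_f[OF x False] add.commute[of _ "ereal (ln (f x))"])
qed (simp add: word_expectation_elog_zero)

lemma step_ge:
  assumes n: "n \<ge> 1" and c: "ereal c \<le> F_min m p A K f n" and x: "x \<in> K"
  shows "ereal (real n * c) + elog (f x) \<le> word_expectation m p A n (\<lambda>B. elog (f (B x)))"
proof (cases "x = 0")
  case False
  then obtain y where y: "y \<in> K" "f y = 1" "x = f x *\<^sub>R y" using f_normalize[OF x] by blast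
  have "ereal (real n * c) \<le> word_expectation m p A n (\<lambda>B. elog (f (B y)))"
    using c y unfolding F_min_def ereal_le_average_iff[OF n] le_INF_iff by blast
  then show ?thesis
    using word_expectation_elog_scale[OF y(1) f_pos[OF x False], of n] add_left_mono
    by (simp only: y(3)[symmetric] elog_f[OF x False] add.commute[of _ "ereal (ln (f x))"])
qed (simp add: f_zero elog_def)

lemma iterate_le:
  assumes step: "\<And>x. x \<in> K \<Longrightarrow>
      word_expectation m p A n (\<lambda>B. elog (f (B x))) \<le> ereal c + elog (f x)"
    and x: "x \<in> K"
  shows "word_expectation m p A (q * n) (\<lambda>B. elog (f (B x))) \<le> ereal (real q * c) + elog (f x)"
proof (induction q)
  case 0
  then show ?case by (simp add: word_expectation_def words_0)
next
  case (Suc q)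
  have "word_expectation m p A (Suc q * n) (\<lambda>B. elog (f (B x))) =
      word_expectation m p A (q * n) (\<lambda>B. word_expectation m p A n (\<lambda>C. elog (f (C (B x)))))"
    \<comment> \<open>The first \<open>q * n\<close> letters carry \<open>x\<close> to
      \<open>B x\<close> in \<open>K\<close>, where \<open>step\<close> estimates the last
      block.\<close>
    using word_expectation_split[of A "q * n" n "\<lambda>B. elog (f (B x))"] by (simp add: add.commute)
  also have "\<dots> \<le> word_expectation m p A (q * n) (\<lambda>B. ereal c + elog (f (B x)))"
    by (intro word_expectation_mono step) (use x word_prod_cone in blast)
  also have "\<dots> = ereal c + word_expectation m p A (q * n) (\<lambda>B. elog (f (B x)))"
    by (simp add: word_expectation_add word_expectation_const)
  also have "\<dots> \<le> ereal c + (ereal (real q * c) + elog (f x))"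
    by (rule add_left_mono[OF Suc.IH])
  also have "\<dots> = ereal (real (Suc q) * c) + elog (f x)"
    by (rule ereal_add_mult_of_nat)
  finally show ?case .
qed

lemma iterate_ge:
  assumes step: "\<And>x. x \<in> K \<Longrightarrow>
      ereal c + elog (f x) \<le> word_expectation m p A n (\<lambda>B. elog (f (B x)))"
    and x: "x \<in> K"
  shows "ereal (real q * c) + elog (f x) \<le> word_expectation m p A (q * n) (\<lambda>B. elog (f (B x)))"
proof (induction q)
  case 0
  then show ?case by (simp add: word_expectation_def words_0)
next
  case (Suc q)
  have "ereal (real (Suc q) * c) + elog (f x) = ereal c + (ereal (real q * c) + elog (f x))"
    by (rule ereal_add_mult_of_nat[symmetric])
  also have "\<dots> \<le> ereal c + word_expectation m p A (q * n) (\<lambda>B. elog (f (B x)))"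
    by (rule add_left_mono[OF Suc.IH])
  also have "\<dots> = word_expectation m p A (q * n) (\<lambda>B. ereal c + elog (f (B x)))"
    by (simp add: word_expectation_add word_expectation_const)
  also have "\<dots> \<le> word_expectation m p A (q * n) (\<lambda>B. word_expectation m p A n (\<lambda>C. elog (f (C (B x)))))"
    by (intro word_expectation_mono step) (use x word_prod_cone in blast)
  also have "\<dots> = word_expectation m p A (Suc q * n) (\<lambda>B. elog (f (B x)))"
    using word_expectation_split[of A "q * n" n "\<lambda>B. elog (f (B x))"] by (simp add: add.commute)
  finally show ?case .
qed

section \<open>The upper and the lower bound\<close>

lemma lyapunov_exponent_le_F_max:
  assumes n: "n \<ge> 1"
  shows "lyapunov_exponent m p A \<le> F_max m p A K f n"
\<comment> \<open>Testing against all real upper bounds \<open>c\<close> covers infinite values of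
  \<open>F_max\<close> as well.\<close>
proof (rule ereal_le_real)
  fix c assume c: "F_max m p A K f n \<le> ereal c"
  obtain e where e: "e \<in> interior K" "e \<noteq> 0" using proper_cone_interior_nonzero[OF K] .
  then have eK: "e \<in> K" using interior_subset by blast
  obtain C where C: "0 < C" "\<And>B. linear B \<Longrightarrow> B ` K \<subseteq> K \<Longrightarrow> onorm B \<le> C * norm (B e)"
    using onorm_le_norm_interior_image[OF K e(1)] by blast
  obtain b where b: "0 < b" "\<And>x. x \<in> K \<Longrightarrow> b * norm x \<le> f x"
    using f_norm unfolding norm_comparable_on_def by blast
  \<comment> \<open>Normality bounds the operator norm by \<open>C * norm (B e)\<close>, and the
    lower half of norm comparability turns this into \<open>C / b * f (B e)\<close>, with constants
    independent of the word.\<close>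
  have est: "elog (onorm (word_prod A ds)) \<le> ereal (ln (C / b)) + elog (f (word_prod A ds e))"
    if ds: "ds \<in> words m k" for k ds
  proof -
    have BK: "word_prod A ds e \<in> K" using word_prod_cone[OF ds] eK by blast
    have "onorm (word_prod A ds) \<le> C / b * (b * norm (word_prod A ds e))"
      using C(2)[OF linear_word_prod[OF ds] word_prod_cone[OF ds]] b(1) by simp
    also have "\<dots> \<le> C / b * f (word_prod A ds e)"
      using b BK C(1) by (intro mult_left_mono) auto
    finally have "elog (onorm (word_prod A ds)) \<le> elog (C / b * f (word_prod A ds e))"
      by (rule elog_mono)
    also have "\<dots> = elog (C / b) + elog (f (word_prod A ds e))"
      using C(1) b(1) f BK by (intro elog_mult) (auto simp: functional_on_def)
    finally show ?thesis using C(1) b(1) by (simp add: elog_def)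
  qed
  have "word_expectation m p A (q * n) (\<lambda>B. elog (onorm B)) \<le>
      ereal (real q * (real n * c) + (ln (C / b) + ln (f e)))" for q
  proof -
    have "word_expectation m p A (q * n) (\<lambda>B. elog (onorm B)) \<le>
        word_expectation m p A (q * n) (\<lambda>B. ereal (ln (C / b)) + elog (f (B e)))"
      using est by (rule word_expectation_mono)
    also have "\<dots> = ereal (ln (C / b)) + word_expectation m p A (q * n) (\<lambda>B. elog (f (B e)))"
      by (simp add: word_expectation_add word_expectation_const)
    also have "\<dots> \<le> ereal (ln (C / b)) + (ereal (real q * (real n * c)) + elog (f e))"
      by (intro add_left_mono iterate_le step_le n c eK)
    also have "\<dots> = ereal (real q * (real n * c) + (ln (C / b) + ln (f e)))"
      using f_pos[OF eK e(2)] by (simp add: elog_def)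
    finally show ?thesis .
  qed
  then show "lyapunov_exponent m p A \<le> ereal c" by (rule lyapunov_exponent_le[OF n])
qed

lemma F_min_le_lyapunov_exponent:
  assumes n: "n \<ge> 1"
  shows "F_min m p A K f n \<le> lyapunov_exponent m p A"
proof (rule dense_le)
  fix l assume "l < F_min m p A K f n"
  then obtain c where lc: "l < ereal c" and c: "ereal c \<le> F_min m p A K f n"
    using ereal_dense2 less_imp_le by meson
  obtain e where e: "e \<in> interior K" "e \<noteq> 0" using proper_cone_interior_nonzero[OF K] .
  then have eK: "e \<in> K" using interior_subset by blast
  obtain b where b: "\<And>x. x \<in> K \<Longrightarrow> f x \<le> b * norm x"
    using f_norm unfolding norm_comparable_on_def by blast
  \<comment> \<open>The upper constant \<open>b\<close> may fail to be positive;
    \<open>max b 1\<close> ensures that \<open>ln C\<close> is the logarithm of a positive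
    number.\<close>
  define C where "C = max b 1 * norm e"
  have C: "0 < C" using e(2) by (simp add: C_def)
  have est: "elog (f (word_prod A ds e)) \<le> ereal (ln C) + elog (onorm (word_prod A ds))"
    if ds: "ds \<in> words m k" for k ds
  proof -
    have "word_prod A ds e \<in> K" using word_prod_cone[OF ds] eK by blast
    then have "f (word_prod A ds e) \<le> b * norm (word_prod A ds e)" by (rule b)
    also have "\<dots> \<le> max b 1 * norm (word_prod A ds e)" by (intro mult_right_mono) auto
    also have "\<dots> \<le> max b 1 * (onorm (word_prod A ds) * norm e)"
      using linear_word_prod[OF ds] by (intro mult_left_mono onorm) (auto simp: linear_linear)
    also have "\<dots> = C * onorm (word_prod A ds)" by (simp add: C_def)
    finally have "elog (f (word_prod A ds e)) \<le> elog (C * onorm (word_prod A ds))"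
      by (rule elog_mono)
    also have "\<dots> = elog C + elog (onorm (word_prod A ds))"
      using C onorm_word_prod_nonneg[OF ds] by (intro elog_mult) auto
    finally show ?thesis using C by (simp add: elog_def)
  qed
  have "ereal (real q * (real n * c) - (ln C - ln (f e))) \<le>
      word_expectation m p A (q * n) (\<lambda>B. elog (onorm B))" for q
  proof -
    have "ereal (real q * (real n * c)) + elog (f e) \<le> word_expectation m p A (q * n) (\<lambda>B. elog (f (B e)))"
      by (intro iterate_ge step_ge n c eK)
    also have "\<dots> \<le> word_expectation m p A (q * n) (\<lambda>B. ereal (ln C) + elog (onorm B))"
      using est by (rule word_expectation_mono)
    also have "\<dots> = ereal (ln C) + word_expectation m p A (q * n) (\<lambda>B. elog (onorm B))"
      by (simp add: word_expectation_add word_expectation_const)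
    finally show ?thesis
      using f_pos[OF eK e(2)]
      \<comment> \<open>Moving \<open>ln C\<close> across the inequality takes a case split, as the
        expectation is an extended real.\<close>
      by (cases "word_expectation m p A (q * n) (\<lambda>B. elog (onorm B))") (auto simp: elog_def)
  qed
  then have "ereal c \<le> lyapunov_exponent m p A" by (rule lyapunov_exponent_ge[OF n])
  then show "l \<le> lyapunov_exponent m p A" using lc by simp
qed

end

theorem lemma2:
  fixes m :: nat and p :: "nat \<Rightarrow> real"
    and A :: "nat \<Rightarrow> real ^ 'd \<Rightarrow> real ^ 'd"
    and K :: "(real ^ 'd) set" and f :: "real ^ 'd \<Rightarrow> real"
  assumes "\<And>j. j \<in> {1..m} \<Longrightarrow> 0 < p j" and "(\<Sum>j = 1..m. p j) = 1"
    and "\<And>j. j \<in> {1..m} \<Longrightarrow> linear (A j)"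
    and "proper_cone K"
    and "\<And>j. j \<in> {1..m} \<Longrightarrow> A j ` K \<subseteq> K"
    and "functional_on K f"
    and "norm_comparable_on K f"
  shows "(\<forall>n\<ge>1. F_min m p A K f n \<le> lyapunov_exponent m p A \<and>
                 lyapunov_exponent m p A \<le> F_max m p A K f n) \<and>
         F_min m p A K f 1 \<le> lyapunov_exponent m p A \<and>
         lyapunov_exponent m p A \<le> F_max m p A K f 1"
proof -
  interpret random_cone_operators m p A K f
    using assms by (intro random_cone_operators.intro word_weights.intro random_cone_operators_axioms.intro)
  show ?thesis
    using F_min_le_lyapunov_exponent lyapunov_exponent_le_F_max by simp
qed

end
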